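(* Let $p\in\mathbb{N}^*$ and $r\in\mathbb{C}^*$. Then for any $a,c\in\ell(\mathbb{C}^*;p,r)$ and $b\in\ell(\mathbb{C};p,r)$, $$q_{p,r}(a;b;c)=\frac12\sqrt{\frac{r}{a^{\pi_p}c^{\pi_p}}}\;\sum_{j=0}^{\lfloor p/2\rfloor}(-1)^j\sum_{\alpha\in\Lambda_p^j}r^{-\alpha_{p-1}}\,a^{\alpha}\,b^{\bar\alpha}\,c^{\alpha}.$$
   Context: $\mathbb{C}^*=\mathbb{C}\setminus\{0\}$, $\mathbb{N}^*=\{1,2,\dots\}$. $\ell(\mathbb{C})$ is the space of sequences $z:\mathbb{Z}\to\mathbb{C}$; $\ell(\mathbb{C};p,r)$ is the set of $z\in\ell(\mathbb{C})$ with $z(k+p)=r\,z(k)$ for all $k\in\mathbb{Z}$; $\ell(\mathbb{C}^*;p,r)$ is the subset of those that never vanish. For $z\in\ell(\mathbb{C})$ and $m\in\mathbb{Z}$, $z_{p,m}(k)=z(kp+m)$. Multi-indices. A binary multi-index of order $p$ is $\alpha=(\alpha_0,\dots,\alpha_{p-1})\in\{0,1\}^p$, with $|\alpha|=\sum_{j=0}^{p-1}\alpha_j$; $\pi_p=(1,\dots,1)$. For a sequence $a$, $a^\alpha=\prod_{j=0}^{p-1}a(j)^{\alpha_j}$ with $0^0=1$ (so $a^{\pi_p}=\prod_{j=0}^{p-1}a(j)$). When $|\alpha|=m$, let $0\le i_1<\dots<i_m\le p-1$ be the indices with $\alpha_{i_1}=\dots=\alpha_{i_m}=1$. Define $\Lambda_p^0=\{(0,\dots,0)\}$;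 for $p\ge2$, $\Lambda_p^1=\{\alpha\in\{0,1\}^p:|\alpha|=1\}$; for $p\ge4$ and $2\le m\le\lfloor p/2\rfloor$, $\Lambda_p^m$ is the set of $\alpha\in\{0,1\}^p$ with $|\alpha|=m$, $i_{j+1}-i_j\ge2$ for $j=1,\dots,m-1$, and $i_m\le p-2$ when $i_1=0$. For $\alpha\in\Lambda_p^m$ with $m\ge1$, $\bar\alpha\in\{0,1\}^p$ is defined by $\bar\alpha_{i_j}=\bar\alpha_{i_j+1}=0$ for $j=1,\dots,m$ and $\bar\alpha_i=1$ otherwise, where if $i_m=p-1$ the index $i_m+1$ is read as $0$; for $\alpha=(0,\dots,0)$, $\bar\alpha=\pi_p$. Floquet function. Given $a,c\in\ell(\mathbb{C}^*;p,r)$, $b\in\ell(\mathbb{C};p,r)$, fix $\gamma=\Big(r\prod_{j=0}^{p-1}\frac{a(j)}{c(j)}\Big)^{-1/2}$ (a fixed choice of square root). Then $q_{p,r}(a;b;c)\in\mathbb{C}$ denotes the number such that for every solution $z\in\ell(\mathbb{C})$ of $a(k)z(k+1)-b(k)z(k)+c(k-1)z(k-1)=0$, $k\in\mathbb{Z}$, and every $m\in\mathbb{Z}$, the sequence $v(k)=\gamma^{-k}z_{p,m}(k)$ satisfies the Chebyshev equation $v(k+1)-2q_{p,r}(a;b;c)v(k)+v(k-1)=0$, $k\in\mathbb{Z}$. (Such a number exists and is unique.) The square root in the claim is taken consistently with $\gamma$: $\sqrt{r/(a^{\pi_p}c^{\pi_p})}$ is the square root equal to $1/(\gamma\,a^{\pi_p})$.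 *)

theory Defs
  imports Complex_Main
begin

definition qper :: "nat \<Rightarrow> complex \<Rightarrow> (int \<Rightarrow> complex) set" where
  "qper p r = {z. \<forall>k. z (k + int p) = r * z k}"

definition qper_nz :: "nat \<Rightarrow> complex \<Rightarrow> (int \<Rightarrow> complex) set" where
  "qper_nz p r = {z \<in> qper p r. \<forall>k. z k \<noteq> 0}"

definition subseq_of :: "nat \<Rightarrow> int \<Rightarrow> (int \<Rightarrow> complex) \<Rightarrow> int \<Rightarrow> complex" where
  "subseq_of p m z = (\<lambda>k. z (k * int p + m))"

text \<open>A multi-index of order \<open>p\<close> is a list of length \<open>p\<close>, so \<open>\<alpha> ! j\<close> is the entry \<open>\<alpha>\<^sub>j\<close>
  (indices start at 0), and \<open>sum_list \<alpha>\<close> is \<open>|\<alpha>|\<close>.\<close>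

definition bin_idx :: "nat \<Rightarrow> nat list set" where
  "bin_idx p = {\<alpha>. length \<alpha> = p \<and> set \<alpha> \<subseteq> {0, 1}}"

definition ones :: "nat \<Rightarrow> nat list" where
  "ones p = replicate p 1"

definition mpow :: "(int \<Rightarrow> complex) \<Rightarrow> nat list \<Rightarrow> complex" where
  "mpow a \<alpha> = (\<Prod>j<length \<alpha>. a (int j) ^ (\<alpha> ! j))"

text \<open>The increasing list \<open>i\<^sub>1 < \<dots> < i\<^sub>m\<close> of the positions of the ones;
  since lists are indexed from 0, \<open>i\<^sub>j\<close> is \<open>supp_idx \<alpha> ! (j - 1)\<close>.\<close>

definition supp_idx :: "nat list \<Rightarrow> nat list" where
  "supp_idx \<alpha> = filter (\<lambda>i. \<alpha> ! i = 1) [0..<length \<alpha>]"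

text \<open>The final branch only gives a value outside the range of \<open>(p, m)\<close> where
  the set is defined; it is never reached for \<open>m \<le> p div 2\<close>.\<close>

definition Lam :: "nat \<Rightarrow> nat \<Rightarrow> nat list set" where
  "Lam p m =
    (if m = 0 then {replicate p 0}
     else if m = 1 \<and> 2 \<le> p then {\<alpha> \<in> bin_idx p. sum_list \<alpha> = 1}
     else if 4 \<le> p \<and> 2 \<le> m \<and> m \<le> p div 2 then
       {\<alpha> \<in> bin_idx p. sum_list \<alpha> = m \<and>
          (\<forall>j\<in>{1..m - 1}. supp_idx \<alpha> ! (j - 1) + 2 \<le> supp_idx \<alpha> ! j) \<and>
          (supp_idx \<alpha> ! 0 = 0 \<longrightarrow> supp_idx \<alpha> ! (m - 1) \<le> p - 2)}
     else {})"

text \<open>The reduction modulo the length reads the successor of the index \<open>p - 1\<close> as \<open>0\<close>.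
  For \<open>\<alpha> = (0, \<dots>, 0)\<close> this gives \<open>(1, \<dots>, 1)\<close>.\<close>

definition bar_idx :: "nat list \<Rightarrow> nat list" where
  "bar_idx \<alpha> =
    map (\<lambda>i. if \<exists>s\<in>set (supp_idx \<alpha>). i = s \<or> i = (s + 1) mod length \<alpha> then 0 else 1)
      [0..<length \<alpha>]"

definition is_solution ::
  "(int \<Rightarrow> complex) \<Rightarrow> (int \<Rightarrow> complex) \<Rightarrow> (int \<Rightarrow> complex) \<Rightarrow> (int \<Rightarrow> complex) \<Rightarrow> bool" where
  "is_solution a b c z \<longleftrightarrow>
    (\<forall>k. a k * z (k + 1) - b k * z k + c (k - 1) * z (k - 1) = 0)"

definition chebyshev_eq :: "complex \<Rightarrow> (int \<Rightarrow> complex) \<Rightarrow> bool" where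
  "chebyshev_eq q v \<longleftrightarrow> (\<forall>k. v (k + 1) - 2 * q * v k + v (k - 1) = 0)"

text \<open>\<open>\<gamma>\<close> is one of the two values of \<open>(r \<Prod>\<^sub>j a(j)/c(j))\<close> to the power \<open>-1/2\<close>.\<close>

definition is_gamma ::
  "nat \<Rightarrow> complex \<Rightarrow> (int \<Rightarrow> complex) \<Rightarrow> (int \<Rightarrow> complex) \<Rightarrow> complex \<Rightarrow> bool" where
  "is_gamma p r a c \<gamma> \<longleftrightarrow> \<gamma>\<^sup>2 = inverse (r * (\<Prod>j<p. a (int j) / c (int j)))"

text \<open>The Floquet function \<open>q\<^sub>p\<^sub>,\<^sub>r(a; b; c)\<close>. It depends on \<open>r\<close> only through the
  chosen square root \<open>\<gamma>\<close>, which is therefore an argument.\<close>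

definition floquet_q ::
  "nat \<Rightarrow> complex \<Rightarrow> (int \<Rightarrow> complex) \<Rightarrow> (int \<Rightarrow> complex) \<Rightarrow> (int \<Rightarrow> complex) \<Rightarrow> complex" where
  "floquet_q p \<gamma> a b c =
    (THE q. \<forall>z. is_solution a b c z \<longrightarrow>
       (\<forall>m. chebyshev_eq q (\<lambda>k. \<gamma> powi (- k) * subseq_of p m z k)))"

text \<open>The root \<open>1 / (\<gamma> a\<^sup>\<pi>)\<close> really is a square root of \<open>r / (a\<^sup>\<pi> c\<^sup>\<pi>)\<close>.\<close>

lemma gamma_consistent_root:
  assumes "r \<noteq> 0" "a \<in> qper_nz p r" "c \<in> qper_nz p r" "is_gamma p r a c \<gamma>"
  shows "(1 / (\<gamma> * mpow a (ones p)))\<^sup>2 = r / (mpow a (ones p) * mpow c (ones p))"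
proof -
  have e: "mpow x (ones p) = (\<Prod>j<p. x (int j))" for x
    by (auto simp: mpow_def ones_def intro!: prod.cong)
  have nz: "mpow a (ones p) \<noteq> 0" "mpow c (ones p) \<noteq> 0"
    using assms by (auto simp: e qper_nz_def)
  have g: "\<gamma>\<^sup>2 = inverse (r * (mpow a (ones p) / mpow c (ones p)))"
    using assms(4) by (simp add: is_gamma_def e prod_dividef)
  have "(1 / (\<gamma> * mpow a (ones p)))\<^sup>2 = 1 / (\<gamma>\<^sup>2 * (mpow a (ones p))\<^sup>2)"
    by (simp add: power_divide power_mult_distrib)
  also have "\<dots> = r / (mpow a (ones p) * mpow c (ones p))"
    unfolding g using nz assms(1) by (simp add: divide_simps power2_eq_square)
  finally show ?thesis .
qed

end

theory Submission
  imports Defs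
begin

text \<open>The Floquet function is, up to a factor, the trace of the monodromy matrix that carries
  \<open>(z(0), z(-1))\<close> to \<open>(z(p), z(p - 1))\<close>, and the sum in the claim is that trace, multiplied by
  \<open>a(0) \<dots> a(p - 1)\<close> and written as a sum over the matchings of a cycle with \<open>p\<close> vertices.

  Clearing the denominators \<open>a(0) \<dots> a(n - 1)\<close>, every solution is expressed through
  \<open>z(0)\<close>, \<open>z(-1)\<close> and two continuants (\<open>solution_eq_continuants\<close>). So the entries of the monodromy
  matrix are continuants, and its determinant comes from the classical determinant identity
  for them (\<open>continuant_determinant\<close>): it equals \<open>\<gamma>\<^sup>2\<close>. By Cayley-Hamilton a solution satisfies
  \<open>z(k + p) - t z(k) + \<gamma>\<^sup>2 z(k - p) = 0\<close> with \<open>t\<close> the trace. It suffices to test this for \<open>k = 0\<close> and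
  \<open>k = -1\<close>, because by periodicity of the coefficients up to the factor \<open>r\<close> the left-hand side is again
  a solution, and a solution with two consecutive zeros vanishes (\<open>floquet_relation\<close>).
  Rescaling by \<open>\<gamma>\<^sup>-\<^sup>k\<close> turns the relation into the Chebyshev equation with \<open>2 q \<gamma> = t\<close>;
  that no other \<open>q\<close> works is seen from a single solution with \<open>z(0) = 1\<close> (\<open>floquet_q_eqI\<close>).

  For the combinatorial side, put the vertices \<open>0, \<dots>, p - 1\<close> on a cycle and let the edge \<open>s\<close>
  join \<open>s\<close> to its successor. Give the vertex \<open>j\<close> the weight \<open>b(j)\<close> and the edge \<open>s\<close> the weight
  \<open>-a(s) c(s)\<close>, with an extra factor \<open>1/r\<close> on the edge \<open>p - 1\<close> that closes the cycle: this factor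
  enters through \<open>c(-1) = c(p - 1)/r\<close>. A continuant is the generating function of the matchings of a path,
  uncovered vertices contributing their weight (\<open>continuant_eq_sum_path_matchings\<close>). According to
  whether the closing edge is used, a matching of the cycle is a matching of the full path or of the path
  without its two ends, and the corresponding continuants are exactly the two terms of the cleared trace
  (\<open>sum_cycle_matchings\<close>). Finally, the multi-indices in the claim are the indicator vectors of the
  matchings of the cycle, and the bar operation produces the indicator of the uncovered vertices.\<close>

section \<open>Continuants and matchings\<close>

text \<open>The index is one more than the number of vertices of the path starting at \<open>i\<close>:
  index \<open>1\<close> is the empty path, and the value \<open>0\<close> at index \<open>0\<close> (a path with \<open>-1\<close> vertices) makes the trace
  formula valid for \<open>p = 1\<close> too. For \<open>i = n = 0\<close> the truncated index \<open>i + n - 1\<close> is harmless, since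
  \<open>e\<close> is then multiplied by \<open>0\<close>.\<close>

fun continuant :: "(nat \<Rightarrow> 'a::comm_ring_1) \<Rightarrow> (nat \<Rightarrow> 'a) \<Rightarrow> nat \<Rightarrow> nat \<Rightarrow> 'a" where
  "continuant e b i 0 = 0"
| "continuant e b i (Suc 0) = 1"
| "continuant e b i (Suc (Suc n)) =
     b (i + n) * continuant e b i (Suc n) + e (i + n - 1) * continuant e b i n"

text \<open>The sequences \<open>continuant e b 0 (Suc n)\<close> and \<open>continuant e b 1 n\<close> solve the same
  three-term recurrence in \<open>n\<close>, and the left-hand side is their Casorati determinant, which each step
  of the recurrence multiplies by \<open>-e n\<close>.\<close>

lemma continuant_determinant:
  "continuant e b 0 (Suc n) * continuant e b 1 (Suc n)
     - continuant e b 0 (Suc (Suc n)) * continuant e b 1 n = (\<Prod>j<n. - e j)"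
proof (induction n)
  case 0
  show ?case by simp
next
  case (Suc n)
  have "continuant e b 0 (Suc (Suc n)) * continuant e b 1 (Suc (Suc n))
      - continuant e b 0 (Suc (Suc (Suc n))) * continuant e b 1 (Suc n)
    = - e n * (continuant e b 0 (Suc n) * continuant e b 1 (Suc n)
        - continuant e b 0 (Suc (Suc n)) * continuant e b 1 n)"
    by (simp add: algebra_simps)
  then show ?case
    unfolding Suc.IH by simp
qed

lemma inj_on_insert_fresh: "(\<And>E. E \<in> A \<Longrightarrow> x \<notin> E) \<Longrightarrow> inj_on (insert x) A"
  by (rule inj_onI) (metis insert_ident)

text \<open>A matching is encoded by the set of initial vertices of its edges, so that it
  matches the support of a multi-index. The path has the vertices \<open>i, \<dots>, i + m - 1\<close>.\<close>

definition path_matchings :: "nat \<Rightarrow> nat \<Rightarrow> nat set set" where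
  "path_matchings i m = {E. \<forall>s\<in>E. i \<le> s \<and> Suc s < i + m \<and> Suc s \<notin> E}"

text \<open>On the cycle with one vertex the only edge is a loop, which is its own
  successor and is therefore excluded; on two vertices there are two parallel edges.\<close>

definition cycle_matchings :: "nat \<Rightarrow> nat set set" where
  "cycle_matchings p = {E. \<forall>s\<in>E. s < p \<and> Suc s mod p \<notin> E}"

lemma finite_path_matchings [simp]: "finite (path_matchings i m)"
  by (rule finite_subset[of _ "Pow {..<i + m}"]) (auto simp: path_matchings_def)

lemma finite_cycle_matchings [simp]: "finite (cycle_matchings p)"
  by (rule finite_subset[of _ "Pow {..<p}"]) (auto simp: cycle_matchings_def)

definition path_weight ::
  "(nat \<Rightarrow> 'a::comm_ring_1) \<Rightarrow> (nat \<Rightarrow> 'a) \<Rightarrow> nat \<Rightarrow> nat \<Rightarrow> nat set \<Rightarrow> 'a" where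
  "path_weight e b i m E = (\<Prod>s\<in>E. e s) * (\<Prod>v\<in>{i..<i + m} - (E \<union> Suc ` E). b v)"

definition cycle_weight ::
  "(nat \<Rightarrow> 'a::comm_ring_1) \<Rightarrow> (nat \<Rightarrow> 'a) \<Rightarrow> nat \<Rightarrow> nat set \<Rightarrow> 'a" where
  "cycle_weight e b p E =
     (\<Prod>s\<in>E. e s) * (\<Prod>v\<in>{..<p} - (E \<union> (\<lambda>s. Suc s mod p) ` E). b v)"

lemma path_matchings_small:
  "path_matchings i 0 = {{}}" "path_matchings i (Suc 0) = {{}}"
  by (auto simp: path_matchings_def)

text \<open>The last vertex \<open>i + m + 1\<close> is either uncovered or joined to \<open>i + m\<close>, and in
  the latter case what remains is a matching of the first \<open>m\<close> vertices.\<close>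

lemma path_matchings_step:
  "path_matchings i (Suc (Suc m)) =
     path_matchings i (Suc m) \<union> insert (i + m) ` path_matchings i m"
proof (intro subset_antisym subsetI)
  fix E assume E: "E \<in> path_matchings i (Suc (Suc m))"
  show "E \<in> path_matchings i (Suc m) \<union> insert (i + m) ` path_matchings i m"
  proof (cases "i + m \<in> E")
    case True
    have "Suc s < i + m" if "s \<in> E - {i + m}" for s
    proof -
      have "s < Suc (i + m)" "s \<noteq> i + m" "Suc s \<noteq> i + m"
        using E True that by (auto simp: path_matchings_def)
      then show ?thesis by linarith
    qed
    then have "E - {i + m} \<in> path_matchings i m"
      using E by (auto simp: path_matchings_def)
    moreover have "E = insert (i + m) (E - {i + m})"
      using True by auto
    ultimately show ?thesis by blast
  next
    case False
    have "Suc s < i + Suc m" if "s \<in> E" for s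
    proof -
      have "s < Suc (i + m)" "s \<noteq> i + m"
        using E False that by (auto simp: path_matchings_def)
      then show ?thesis by linarith
    qed
    then show ?thesis
      using E by (auto simp: path_matchings_def)
  qed
next
  fix E assume "E \<in> path_matchings i (Suc m) \<union> insert (i + m) ` path_matchings i m"
  then show "E \<in> path_matchings i (Suc (Suc m))"
    by (force simp: path_matchings_def)
qed

lemma path_weight_skip:
  assumes "E \<in> path_matchings i (Suc m)"
  shows "path_weight e b i (Suc (Suc m)) E = b (i + Suc m) * path_weight e b i (Suc m) E"
proof -
  have "{i..<i + Suc (Suc m)} - (E \<union> Suc ` E)
      = insert (i + Suc m) ({i..<i + Suc m} - (E \<union> Suc ` E))"
    using assms by (force simp: path_matchings_def)
  then show ?thesis
    by (simp add: path_weight_def algebra_simps)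
qed

lemma path_weight_insert:
  assumes "E \<in> path_matchings i m"
  shows "path_weight e b i (Suc (Suc m)) (insert (i + m) E) = e (i + m) * path_weight e b i m E"
proof -
  have "finite E"
    using assms by (intro finite_subset[of E "{..<i + m}"]) (auto simp: path_matchings_def)
  moreover have "i + m \<notin> E"
    using assms by (auto simp: path_matchings_def)
  moreover have "{i..<i + Suc (Suc m)} - (insert (i + m) E \<union> Suc ` insert (i + m) E)
      = {i..<i + m} - (E \<union> Suc ` E)"
    by auto
  ultimately show ?thesis
    by (simp add: path_weight_def algebra_simps)
qed

lemma sum_path_matchings_step:
  "(\<Sum>E\<in>path_matchings i (Suc (Suc m)). path_weight e b i (Suc (Suc m)) E) =
     b (i + Suc m) * (\<Sum>E\<in>path_matchings i (Suc m). path_weight e b i (Suc m) E)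
     + e (i + m) * (\<Sum>E\<in>path_matchings i m. path_weight e b i m E)"
proof -
  have inj: "inj_on (insert (i + m)) (path_matchings i m)"
    by (rule inj_on_insert_fresh) (auto simp: path_matchings_def)
  have "path_matchings i (Suc m) \<inter> insert (i + m) ` path_matchings i m = {}"
    by (auto simp: path_matchings_def)
  then show ?thesis
    by (simp add: path_matchings_step sum.union_disjoint sum.reindex[OF inj]
        path_weight_skip path_weight_insert sum_distrib_left)
qed

text \<open>Both sides obey the same recurrence, by the fate of the last vertex.\<close>

lemma continuant_eq_sum_path_matchings:
  "continuant e b i (Suc m) = (\<Sum>E\<in>path_matchings i m. path_weight e b i m E)"
proof (induction m rule: induct_nat_012)
  case 0
  show ?case by (simp add: path_matchings_small path_weight_def)
next
  case 1
  show ?case by (simp add: path_matchings_small path_weight_def)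
next
  case (ge2 m)
  then show ?case by (simp add: sum_path_matchings_step)
qed

text \<open>The closing edge \<open>p - 1\<close> covers the vertices \<open>p - 1\<close> and \<open>0\<close>. A matching that uses
  it is otherwise a matching of the path \<open>1, \<dots>, p - 2\<close>; a matching that avoids it lives on the path
  \<open>0, \<dots>, p - 1\<close>.\<close>

lemma cycle_matchings_split:
  assumes "2 \<le> p"
  shows "cycle_matchings p =
    path_matchings 0 p \<union> insert (p - 1) ` path_matchings 1 (p - 2)"
proof (intro subset_antisym subsetI)
  fix E assume E: "E \<in> cycle_matchings p"
  have suc: "Suc s \<notin> E" if "s \<in> E" "Suc s < p" for s
    using E that mod_less[of "Suc s" p] unfolding cycle_matchings_def by (metis (lifting) mem_Collect_eq)
  have lt: "s < p" if "s \<in> E" for s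
    using E that by (auto simp: cycle_matchings_def)
  show "E \<in> path_matchings 0 p \<union> insert (p - 1) ` path_matchings 1 (p - 2)"
  proof (cases "p - 1 \<in> E")
    case True
    then have "Suc (p - 1) mod p \<notin> E"
      using E unfolding cycle_matchings_def by blast
    then have "0 \<notin> E"
      using assms by simp
    have "1 \<le> s \<and> Suc s < 1 + (p - 2) \<and> Suc s \<notin> E - {p - 1}" if "s \<in> E - {p - 1}" for s
    proof -
      have "s \<noteq> 0" "Suc s < p"
        using that \<open>0 \<notin> E\<close> lt[of s] by (metis DiffD1, auto)
      moreover from this have "Suc s \<notin> E"
        using suc that by auto
      moreover from this have "Suc s \<noteq> p - 1"
        using True by auto
      ultimately show ?thesis by auto
    qed
    then have "E - {p - 1} \<in> path_matchings 1 (p - 2)"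
      unfolding path_matchings_def by blast
    moreover have "E = insert (p - 1) (E - {p - 1})"
      using True by auto
    ultimately show ?thesis by blast
  next
    case False
    have "Suc s < p" if "s \<in> E" for s
    proof -
      have "s < p" "s \<noteq> p - 1"
        using lt False that by auto
      then show ?thesis by linarith
    qed
    then show ?thesis
      using suc by (auto simp: path_matchings_def)
  qed
next
  fix E assume "E \<in> path_matchings 0 p \<union> insert (p - 1) ` path_matchings 1 (p - 2)"
  then show "E \<in> cycle_matchings p"
  proof
    assume "E \<in> path_matchings 0 p"
    then show ?thesis
      by (auto simp: path_matchings_def cycle_matchings_def)
  next
    assume "E \<in> insert (p - 1) ` path_matchings 1 (p - 2)"
    then obtain F where F: "E = insert (p - 1) F" "F \<in> path_matchings 1 (p - 2)"
      by blast
    have "s < p \<and> Suc s mod p \<notin> E" if "s \<in> E" for s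
    proof (cases "s = p - 1")
      case True
      then show ?thesis
        using F assms by (auto simp: path_matchings_def)
    next
      case False
      then have "s \<in> F" using that F by auto
      then have "Suc s < p - 1" "Suc s \<notin> F"
        using F assms by (auto simp: path_matchings_def)
      then show ?thesis
        using F by auto
    qed
    then show ?thesis
      by (simp add: cycle_matchings_def)
  qed
qed

lemma cycle_weight_path:
  assumes "E \<in> path_matchings 0 p"
  shows "cycle_weight e b p E = path_weight e b 0 p E"
proof -
  have "(\<lambda>s. Suc s mod p) ` E = Suc ` E"
    using assms by (intro image_cong) (auto simp: path_matchings_def)
  then show ?thesis
    by (simp add: cycle_weight_def path_weight_def atLeast0LessThan)
qed

lemma cycle_weight_wrap:
  assumes "2 \<le> p" "E \<in> path_matchings 1 (p - 2)"
  shows "cycle_weight e b p (insert (p - 1) E) = e (p - 1) * path_weight e b 1 (p - 2) E"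
proof -
  have "finite E"
    using assms by (intro finite_subset[of E "{..<p}"]) (auto simp: path_matchings_def)
  moreover have "p - 1 \<notin> E"
    using assms by (auto simp: path_matchings_def)
  moreover have "{..<p} - (insert (p - 1) E \<union> (\<lambda>s. Suc s mod p) ` insert (p - 1) E)
      = {1..<1 + (p - 2)} - (E \<union> Suc ` E)"
  proof -
    have "(\<lambda>s. Suc s mod p) ` E = Suc ` E"
      using assms by (intro image_cong) (auto simp: path_matchings_def)
    then have "(\<lambda>s. Suc s mod p) ` insert (p - 1) E = insert 0 (Suc ` E)"
      using assms(1) by simp
    then show ?thesis
      using assms(1) by auto
  qed
  ultimately show ?thesis
    by (simp add: cycle_weight_def path_weight_def algebra_simps)
qed

lemma sum_cycle_matchings:
  assumes "1 \<le> p"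
  shows "(\<Sum>E\<in>cycle_matchings p. cycle_weight e b p E) =
    continuant e b 0 (Suc p) + e (p - 1) * continuant e b 1 (p - 1)"
proof (cases "p = 1")
  case True
  have "cycle_matchings 1 = {{}}"
    by (auto simp: cycle_matchings_def)
  then show ?thesis
    using True by (simp add: cycle_weight_def)
next
  case False
  then have p: "2 \<le> p" using assms by simp
  then have p1: "p - 1 = Suc (p - 2)" by simp
  have inj: "inj_on (insert (p - 1)) (path_matchings 1 (p - 2))"
    using p by (intro inj_on_insert_fresh) (auto simp: path_matchings_def)
  have "path_matchings 0 p \<inter> insert (p - 1) ` path_matchings 1 (p - 2) = {}"
    by (auto simp: path_matchings_def)
  then have "(\<Sum>E\<in>cycle_matchings p. cycle_weight e b p E) =
      (\<Sum>E\<in>path_matchings 0 p. cycle_weight e b p E)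
      + (\<Sum>E\<in>path_matchings 1 (p - 2). cycle_weight e b p (insert (p - 1) E))"
    unfolding cycle_matchings_split[OF p]
    by (subst sum.union_disjoint) (simp_all only: sum.reindex[OF inj] comp_def
        finite_path_matchings finite_imageI)
  also have "\<dots> = (\<Sum>E\<in>path_matchings 0 p. path_weight e b 0 p E)
      + (\<Sum>E\<in>path_matchings 1 (p - 2). e (p - 1) * path_weight e b 1 (p - 2) E)"
    by (simp only: cycle_weight_path cycle_weight_wrap[OF p] cong: sum.cong)
  finally show ?thesis
    unfolding p1 continuant_eq_sum_path_matchings by (simp add: sum_distrib_left)
qed

section \<open>Multi-indices as cycle matchings\<close>

definition indicator_list :: "nat \<Rightarrow> nat set \<Rightarrow> nat list" where
  "indicator_list p E = map (\<lambda>i. if i \<in> E then 1 else 0) [0..<p]"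

lemma length_indicator_list [simp]: "length (indicator_list p E) = p"
  by (simp add: indicator_list_def)

lemma nth_indicator_list: "i < p \<Longrightarrow> indicator_list p E ! i = (if i \<in> E then 1 else 0)"
  by (simp add: indicator_list_def)

lemma sum_list_indicator_list: "E \<subseteq> {..<p} \<Longrightarrow> sum_list (indicator_list p E) = card E"
proof -
  assume E: "E \<subseteq> {..<p}"
  have "sum_list (indicator_list p E) = (\<Sum>i<p. if i \<in> E then 1 else 0)"
    by (simp add: indicator_list_def interv_sum_list_conv_sum_set_nat atLeast0LessThan)
  also have "\<dots> = card ({..<p} \<inter> E)"
    by (simp add: sum.If_cases)
  finally show ?thesis
    using E by (simp add: Int_absorb1)
qed

lemma supp_idx_indicator_list: "supp_idx (indicator_list p E) = filter (\<lambda>i. i \<in> E) [0..<p]"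
  unfolding supp_idx_def length_indicator_list
  by (rule filter_cong) (auto simp: nth_indicator_list)

lemma mpow_indicator_list:
  assumes "E \<subseteq> {..<p}"
  shows "mpow x (indicator_list p E) = (\<Prod>s\<in>E. x (int s))"
proof -
  have "mpow x (indicator_list p E) = (\<Prod>j<p. if j \<in> E then x (int j) else 1)"
    unfolding mpow_def length_indicator_list
    by (rule prod.cong) (auto simp: nth_indicator_list)
  also have "\<dots> = (\<Prod>s\<in>{..<p} \<inter> E. x (int s))"
    by (simp add: prod.If_cases)
  finally show ?thesis
    using assms by (simp add: Int_absorb1)
qed

lemma bar_idx_indicator_list:
  assumes "E \<subseteq> {..<p}"
  shows "bar_idx (indicator_list p E) =
    indicator_list p ({..<p} - (E \<union> (\<lambda>s. Suc s mod p) ` E))"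
proof -
  have "set (supp_idx (indicator_list p E)) = E"
    using assms by (auto simp: supp_idx_indicator_list)
  then show ?thesis
    unfolding bar_idx_def length_indicator_list by (auto simp: indicator_list_def)
qed

lemma bin_idx_eq: "bin_idx p = indicator_list p ` Pow {..<p}"
proof (intro subset_antisym subsetI)
  fix \<alpha> assume \<alpha>: "\<alpha> \<in> bin_idx p"
  have "\<alpha> = indicator_list p {i. i < p \<and> \<alpha> ! i = 1}"
  proof (rule nth_equalityI)
    fix i assume "i < length \<alpha>"
    then have "\<alpha> ! i \<in> {0, 1}" "i < p"
      using \<alpha> nth_mem by (fastforce simp: bin_idx_def)+
    then show "\<alpha> ! i = indicator_list p {i. i < p \<and> \<alpha> ! i = 1} ! i"
      by (auto simp: nth_indicator_list)
  qed (use \<alpha> in \<open>simp add: bin_idx_def\<close>)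
  then show "\<alpha> \<in> indicator_list p ` Pow {..<p}"
    by blast
next
  fix \<alpha> assume "\<alpha> \<in> indicator_list p ` Pow {..<p}"
  then show "\<alpha> \<in> bin_idx p"
    by (auto simp: bin_idx_def indicator_list_def)
qed

lemma inj_on_indicator_list: "inj_on (indicator_list p) (Pow {..<p})"
proof (rule inj_onI)
  fix E F assume EF: "E \<in> Pow {..<p}" "F \<in> Pow {..<p}" "indicator_list p E = indicator_list p F"
  have "i \<in> E \<longleftrightarrow> i \<in> F" if "i < p" for i
    using arg_cong[OF EF(3), of "\<lambda>\<alpha>. \<alpha> ! i"] that by (auto simp: nth_indicator_list split: if_splits)
  then show "E = F"
    using EF(1,2) by blast
qed

text \<open>In a strictly increasing list, two entries that differ by \<open>1\<close> must be
  neighbours; this translates the gap condition on the positions of the ones into a property of the support.\<close>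

lemma gaps_iff_no_successor:
  fixes L :: "nat list"
  assumes L: "sorted_wrt (<) L"
  shows "(\<forall>j\<in>{1..length L - 1}. L ! (j - 1) + 2 \<le> L ! j) \<longleftrightarrow> (\<forall>s\<in>set L. Suc s \<notin> set L)"
proof
  assume gaps: "\<forall>j\<in>{1..length L - 1}. L ! (j - 1) + 2 \<le> L ! j"
  show "\<forall>s\<in>set L. Suc s \<notin> set L"
  proof (intro ballI notI)
    fix s assume "s \<in> set L" "Suc s \<in> set L"
    then obtain i j where ij: "i < length L" "j < length L" "L ! i = s" "L ! j = Suc s"
      by (auto simp: in_set_conv_nth)
    have "i < j"
    proof (rule ccontr)
      assume "\<not> i < j"
      then have "L ! j \<le> L ! i"
        using sorted_wrt_nth_less[OF L, of j i] ij by (cases "i = j") auto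
      then show False using ij by simp
    qed
    then have "s + 2 \<le> L ! Suc i"
      using gaps[rule_format, of "Suc i"] ij by simp
    moreover have "L ! Suc i \<le> L ! j"
      using sorted_wrt_nth_less[OF L, of "Suc i" j] ij \<open>i < j\<close> by (cases "Suc i = j") auto
    ultimately show False
      using ij by simp
  qed
next
  assume nosucc: "\<forall>s\<in>set L. Suc s \<notin> set L"
  show "\<forall>j\<in>{1..length L - 1}. L ! (j - 1) + 2 \<le> L ! j"
  proof
    fix j assume j: "j \<in> {1..length L - 1}"
    then have lt: "L ! (j - 1) < L ! j"
      by (intro sorted_wrt_nth_less[OF L]) auto
    have "L ! (j - 1) \<in> set L" "L ! j \<in> set L"
      using j by auto
    then have "L ! j \<noteq> Suc (L ! (j - 1))"
      using nosucc by metis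
    then show "L ! (j - 1) + 2 \<le> L ! j"
      using lt by linarith
  qed
qed

text \<open>For \<open>p \<ge> 2\<close> the cyclic condition is the linear one together with one condition at
  the closing edge, which is the shape that the conditions on multi-indices have.\<close>

lemma cycle_matchings_iff:
  assumes "2 \<le> p"
  shows "E \<in> cycle_matchings p \<longleftrightarrow>
    E \<subseteq> {..<p} \<and> (\<forall>s\<in>E. Suc s \<notin> E) \<and> (0 \<in> E \<longrightarrow> p - 1 \<notin> E)"
proof
  assume E: "E \<in> cycle_matchings p"
  have "Suc s \<notin> E" if "s \<in> E" for s
  proof
    assume "Suc s \<in> E"
    then have "Suc s mod p = Suc s"
      using E by (auto simp: cycle_matchings_def)
    then show False
      using E that \<open>Suc s \<in> E\<close> unfolding cycle_matchings_def by (metis (lifting) mem_Collect_eq)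
  qed
  moreover have "p - 1 \<notin> E" if "0 \<in> E"
  proof
    assume "p - 1 \<in> E"
    then have "Suc (p - 1) mod p \<notin> E"
      using E unfolding cycle_matchings_def by blast
    then show False
      using assms that by simp
  qed
  ultimately show "E \<subseteq> {..<p} \<and> (\<forall>s\<in>E. Suc s \<notin> E) \<and> (0 \<in> E \<longrightarrow> p - 1 \<notin> E)"
    using E by (auto simp: cycle_matchings_def)
next
  assume E: "E \<subseteq> {..<p} \<and> (\<forall>s\<in>E. Suc s \<notin> E) \<and> (0 \<in> E \<longrightarrow> p - 1 \<notin> E)"
  have "Suc s mod p \<notin> E" if "s \<in> E" for s
  proof (cases "s = p - 1")
    case True
    then show ?thesis using E assms that by auto
  next
    case False
    then have "Suc s < p" using E that by fastforce
    then show ?thesis using E that by simp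
  qed
  then show "E \<in> cycle_matchings p"
    using E by (auto simp: cycle_matchings_def)
qed

text \<open>The initial and the final vertices of the edges are disjoint sets of the same size.
  This is why the sum over \<open>j \<le> p div 2\<close> already exhausts all matchings.\<close>

lemma card_cycle_matching_le:
  assumes "E \<in> cycle_matchings p"
  shows "card E \<le> p div 2"
proof -
  have sub: "E \<subseteq> {..<p}" and fin: "finite E"
    using assms by (auto simp: cycle_matchings_def intro: finite_subset[of E "{..<p}"])
  have "inj_on (\<lambda>s. Suc s mod p) {..<p}"
    by (rule inj_onI) (auto simp: mod_Suc split: if_splits)
  then have "card ((\<lambda>s. Suc s mod p) ` E) = card E"
    using sub by (intro card_image) (rule inj_on_subset)
  moreover have "card (E \<union> (\<lambda>s. Suc s mod p) ` E) = card E + card ((\<lambda>s. Suc s mod p) ` E)"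
    using assms fin by (intro card_Un_disjoint) (auto simp: cycle_matchings_def)
  moreover have "card (E \<union> (\<lambda>s. Suc s mod p) ` E) \<le> card {..<p}"
    using sub by (intro card_mono) auto
  ultimately show ?thesis by simp
qed

text \<open>The case distinction in the definition of the multi-index sets dissolves here: no
  multi-index of weight \<open>0\<close> or (for \<open>p \<ge> 2\<close>) \<open>1\<close> can violate the matching condition, and for weight
  \<open>\<ge> 2\<close> the stated gap conditions are the matching condition, the one on the first and last position
  being that at the closing edge.\<close>

lemma Lam_eq_cycle_matchings:
  assumes p: "1 \<le> p" and m: "m \<le> p div 2"
  shows "Lam p m = indicator_list p ` {E \<in> cycle_matchings p. card E = m}"
proof -
  have fin: "finite E" if "E \<in> cycle_matchings p" for E
    using that by (auto simp: cycle_matchings_def intro: finite_subset[of E "{..<p}"])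
  consider "m = 0" | "m = 1" "2 \<le> p" | "2 \<le> m" "4 \<le> p"
    using m by linarith
  then show ?thesis
  proof cases
    case 1
    have "{E \<in> cycle_matchings p. card E = 0} = {{}}"
      using fin by (auto simp: cycle_matchings_def)
    then show ?thesis
      using 1 by (simp add: Lam_def indicator_list_def map_replicate_const)
  next
    case 2
    have "E \<in> cycle_matchings p" if "E \<subseteq> {..<p}" "card E = 1" for E
      using that 2 by (auto simp: cycle_matchings_iff card_1_singleton_iff)
    then have "{E \<in> cycle_matchings p. card E = 1} = {E \<in> Pow {..<p}. card E = 1}"
      by (auto simp: cycle_matchings_def)
    then show ?thesis
      using 2 by (auto simp: Lam_def bin_idx_eq sum_list_indicator_list)
  next
    case 3
    define admissible where "admissible \<alpha> \<longleftrightarrow>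
        (\<forall>j\<in>{1..m - 1}. supp_idx \<alpha> ! (j - 1) + 2 \<le> supp_idx \<alpha> ! j) \<and>
        (supp_idx \<alpha> ! 0 = 0 \<longrightarrow> supp_idx \<alpha> ! (m - 1) \<le> p - 2)" for \<alpha>
    have key: "admissible (indicator_list p E) \<longleftrightarrow> E \<in> cycle_matchings p"
      if E: "E \<subseteq> {..<p}" "card E = m" for E
    proof -
      define L where "L = supp_idx (indicator_list p E)"
      have setL: "set L = E"
        using E by (auto simp: L_def supp_idx_indicator_list)
      have L: "sorted_wrt (<) L"
        by (simp add: L_def supp_idx_indicator_list sorted_wrt_filter)
      have "distinct L"
        by (simp add: L_def supp_idx_indicator_list)
      then have len: "length L = m"
        using distinct_card setL E by metis
      have first: "L ! 0 = 0 \<longleftrightarrow> 0 \<in> E"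
      proof
        assume "L ! 0 = 0"
        then show "0 \<in> E"
          using nth_mem[of 0 L] len 3 setL by simp
      next
        assume "0 \<in> E"
        then obtain i where "i < length L" "L ! i = 0"
          using setL by (metis in_set_conv_nth)
        then show "L ! 0 = 0"
          using sorted_wrt_nth_less[OF L, of 0 i] by (cases "i = 0") auto
      qed
      have last: "L ! (m - 1) \<le> p - 2 \<longleftrightarrow> p - 1 \<notin> E"
      proof
        assume le: "L ! (m - 1) \<le> p - 2"
        show "p - 1 \<notin> E"
        proof
          assume "p - 1 \<in> E"
          then obtain i where i: "i < length L" "L ! i = p - 1"
            using setL by (metis in_set_conv_nth)
          then have "i = m - 1 \<or> i < m - 1"
            using len by linarith
          then have "L ! i \<le> L ! (m - 1)"
            using sorted_wrt_nth_less[OF L, of i "m - 1"] len 3 by auto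
          then show False
            using le i 3 by simp
        qed
      next
        assume "p - 1 \<notin> E"
        moreover have "L ! (m - 1) \<in> E"
          using nth_mem[of "m - 1" L] len 3 setL by simp
        ultimately have "L ! (m - 1) < p" "L ! (m - 1) \<noteq> p - 1"
          using E by auto
        then show "L ! (m - 1) \<le> p - 2"
          by linarith
      qed
      have gaps: "(\<forall>j\<in>{1..m - 1}. L ! (j - 1) + 2 \<le> L ! j) \<longleftrightarrow> (\<forall>s\<in>E. Suc s \<notin> E)"
        using gaps_iff_no_successor[OF L] unfolding len setL .
      show ?thesis
        unfolding admissible_def L_def[symmetric] gaps first last using E 3 by (simp add: cycle_matchings_iff)
    qed
    have sub: "E \<subseteq> {..<p}" if "E \<in> cycle_matchings p" for E
      using that by (auto simp: cycle_matchings_def)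
    have "Lam p m = {\<alpha> \<in> indicator_list p ` Pow {..<p}. sum_list \<alpha> = m \<and> admissible \<alpha>}"
      using 3 m by (simp add: Lam_def bin_idx_eq admissible_def)
    also have "\<dots> = indicator_list p `
        {E \<in> Pow {..<p}. sum_list (indicator_list p E) = m \<and> admissible (indicator_list p E)}"
      by blast
    also have "{E \<in> Pow {..<p}. sum_list (indicator_list p E) = m \<and> admissible (indicator_list p E)}
        = {E \<in> Pow {..<p}. card E = m \<and> E \<in> cycle_matchings p}"
      using key by (auto simp: sum_list_indicator_list)
    also have "{E \<in> Pow {..<p}. card E = m \<and> E \<in> cycle_matchings p}
        = {E \<in> cycle_matchings p. card E = m}"
      using sub by auto
    finally show ?thesis .
  qed
qed

lemma sum_Lam_eq_sum_cycle_matchings: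
  fixes f :: "nat list \<Rightarrow> complex"
  assumes p: "1 \<le> p"
  shows "(\<Sum>j = 0..p div 2. (-1) ^ j * (\<Sum>\<alpha>\<in>Lam p j. f \<alpha>)) =
    (\<Sum>E\<in>cycle_matchings p. (-1) ^ card E * f (indicator_list p E))"
proof -
  have inj: "inj_on (indicator_list p) {E \<in> cycle_matchings p. card E = j}" for j
    by (rule inj_on_subset[OF inj_on_indicator_list]) (auto simp: cycle_matchings_def)
  have "(\<Sum>j = 0..p div 2. (-1) ^ j * (\<Sum>\<alpha>\<in>Lam p j. f \<alpha>)) =
      (\<Sum>j = 0..p div 2. \<Sum>E\<in>{E \<in> cycle_matchings p. card E = j}.
         (-1) ^ card E * f (indicator_list p E))"
    by (rule sum.cong)
      (auto simp: Lam_eq_cycle_matchings[OF p] sum.reindex[OF inj] sum_distrib_left)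
  also have "\<dots> = (\<Sum>E\<in>cycle_matchings p. (-1) ^ card E * f (indicator_list p E))"
    by (rule sum.group) (auto simp: card_cycle_matching_le)
  finally show ?thesis .
qed

section \<open>Solutions\<close>

lemma qperD: "z \<in> qper p r \<Longrightarrow> z (k + int p) = r * z k"
  by (simp add: qper_def)

lemma qper_pred:
  assumes "z \<in> qper p r"
  shows "z (k + int p - 1) = r * z (k - 1)"
  using qperD[OF assms, of "k - 1"] by (simp add: algebra_simps)

text \<open>Shifting by \<open>p\<close> multiplies all three coefficients by the same nonzero factor \<open>r\<close>.\<close>

lemma is_solution_shift:
  assumes "r \<noteq> 0" "a \<in> qper p r" "b \<in> qper p r" "c \<in> qper p r"
  shows "is_solution a b c (\<lambda>k. z (k + int p)) \<longleftrightarrow> is_solution a b c z"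
proof -
  define R where "R k = a k * z (k + 1) - b k * z k + c (k - 1) * z (k - 1)" for k
  define R' where
    "R' k = a k * z (k + 1 + int p) - b k * z (k + int p) + c (k - 1) * z (k - 1 + int p)" for k
  have "R (k + int p) = r * R' k" for k
    using qperD[OF assms(2), of k] qperD[OF assms(3), of k] qper_pred[OF assms(4), of k]
    by (simp add: R_def R'_def algebra_simps)
  then have "R' k = 0 \<longleftrightarrow> R (k + int p) = 0" for k
    using assms(1) by simp
  moreover have "(\<forall>k. R (k + int p) = 0) \<longleftrightarrow> (\<forall>k. R k = 0)"
    by (metis diff_add_cancel)
  ultimately show ?thesis
    unfolding is_solution_def R_def R'_def by simp
qed

lemma is_solution_combination:
  assumes "is_solution a b c x" "is_solution a b c y" "is_solution a b c z"
  shows "is_solution a b c (\<lambda>k. x k - t * y k + d * z k)"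
  unfolding is_solution_def
proof
  fix k
  have "a k * (x (k + 1) - t * y (k + 1) + d * z (k + 1)) - b k * (x k - t * y k + d * z k)
      + c (k - 1) * (x (k - 1) - t * y (k - 1) + d * z (k - 1))
    = (a k * x (k + 1) - b k * x k + c (k - 1) * x (k - 1))
      - t * (a k * y (k + 1) - b k * y k + c (k - 1) * y (k - 1))
      + d * (a k * z (k + 1) - b k * z k + c (k - 1) * z (k - 1))"
    by (simp add: algebra_simps)
  also have "\<dots> = 0"
    using assms by (simp add: is_solution_def)
  finally show "a k * (x (k + 1) - t * y (k + 1) + d * z (k + 1))
      - b k * (x k - t * y k + d * z k)
      + c (k - 1) * (x (k - 1) - t * y (k - 1) + d * z (k - 1)) = 0" .
qed

lemma solution_zero:
  assumes sol: "is_solution a b c z" and nz: "\<And>k. a k \<noteq> 0" "\<And>k. c k \<noteq> 0"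
    and init: "z 0 = 0" "z (-1) = 0"
  shows "z k = 0"
proof -
  have eq: "a k * z (k + 1) - b k * z k + c (k - 1) * z (k - 1) = 0" for k
    using sol by (simp add: is_solution_def)
  have "z k = 0 \<and> z (k - 1) = 0"
  proof (induction k rule: int_induct[where k = 0])
    case base
    show ?case using init by simp
  next
    case (step1 i)
    then show ?case using eq[of i] nz by simp
  next
    case (step2 i)
    then show ?case using eq[of "i - 1"] nz by simp
  qed
  then show ?thesis ..
qed

fun second_order_rec :: "(nat \<Rightarrow> complex) \<Rightarrow> (nat \<Rightarrow> complex) \<Rightarrow> complex \<Rightarrow> complex \<Rightarrow> nat \<Rightarrow> complex"
where
  "second_order_rec f g x y 0 = x"
| "second_order_rec f g x y (Suc 0) = y"
| "second_order_rec f g x y (Suc (Suc n)) =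
     f n * second_order_rec f g x y (Suc n) + g n * second_order_rec f g x y n"

text \<open>As neither \<open>a\<close> nor \<open>c\<close> vanishes, the equation can be solved for the next value and for
  the previous value, hence run in both directions from \<open>z(0) = 1\<close> and \<open>z(1) = 0\<close>.\<close>

lemma ex_solution_nonzero:
  assumes nz: "\<And>k. a k \<noteq> 0" "\<And>k. c k \<noteq> 0"
  shows "\<exists>z. is_solution a b c z \<and> z 0 = 1"
proof -
  \<comment> \<open>\<open>u\<close> runs to the right and \<open>v\<close> to the left; the value \<open>b 0 / c (-1)\<close> of \<open>z(-1)\<close> is forced by the
    equation at \<open>0\<close>.\<close>
  define u where "u = second_order_rec (\<lambda>n. b (int n + 1) / a (int n + 1))
    (\<lambda>n. - c (int n) / a (int n + 1)) 1 0"
  define v where "v = second_order_rec (\<lambda>n. b (- int n - 1) / c (- int n - 2))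
    (\<lambda>n. - a (- int n - 1) / c (- int n - 2)) 1 (b 0 / c (-1))"
  define z where "z k = (if k \<ge> 0 then u (nat k) else v (nat (- k)))" for k
  have zu: "z (int n) = u n" for n
    by (simp add: z_def)
  have zv: "z (- int n) = v n" for n
    by (cases "n = 0") (simp_all add: z_def u_def v_def)
  have "a k * z (k + 1) - b k * z k + c (k - 1) * z (k - 1) = 0" for k
  proof -
    consider n where "k = int n + 1" | "k = 0" | n where "k = - int n - 1"
    proof (cases k "0 :: int" rule: linorder_cases)
      case less
      then have "k = - int (nat (- k - 1)) - 1" by simp
      then show ?thesis using that by blast
    next
      case equal
      then show ?thesis using that by blast
    next
      case greater
      then have "k = int (nat (k - 1)) + 1" by simp
      then show ?thesis using that by blast
    qed
    then show ?thesis
    proof cases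
      case (1 n)
      have "z (k + 1) = u (Suc (Suc n))" "z k = u (Suc n)" "z (k - 1) = u n"
        using zu[of "Suc (Suc n)"] zu[of "Suc n"] zu[of n] 1 by (simp_all add: algebra_simps)
      then show ?thesis
        using 1 nz by (simp add: u_def field_simps)
    next
      case 2
      have "z 1 = 0" "z 0 = 1" "z (-1) = b 0 / c (-1)"
        using zu[of 1] zu[of 0] zv[of 1] by (simp_all add: u_def v_def)
      then show ?thesis
        using 2 nz by simp
    next
      case (3 n)
      have idx: "- int n - 2 = - int (Suc (Suc n))" "- int n - 1 = - int (Suc n)"
        by simp_all
      have "z (- int n - 2) = v (Suc (Suc n))" "z (- int n - 1) = v (Suc n)" "z (- int n) = v n"
        by (simp_all only: idx zv)
      moreover have "c (- int n - 2) * v (Suc (Suc n)) =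
          b (- int n - 1) * v (Suc n) - a (- int n - 1) * v n"
        using nz(2)[of "- int n - 2"] by (simp add: v_def field_simps)
      moreover have "- int n - 1 - 1 = - int n - 2" "- int n - 1 + 1 = - int n"
        by simp_all
      ultimately show ?thesis
        unfolding 3 by (simp only:) simp
    qed
  qed
  moreover have "z 0 = 1"
    using zu[of 0] by (simp add: u_def)
  ultimately show ?thesis
    unfolding is_solution_def by blast
qed

text \<open>The recurrence for \<open>z\<close>, multiplied by the product of the leading coefficients,
  becomes the recurrence of continuants with vertex weights \<open>b\<close> and edge weights \<open>-a c\<close>. The edge weights
  are prescribed only where the path \<open>0, \<dots>, N - 1\<close> has an edge, which leaves the closing edge of the cycle
  free.\<close>

lemma solution_eq_continuants:
  fixes a b c z :: "int \<Rightarrow> complex"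
  assumes sol: "is_solution a b c z"
    and e: "\<And>j. Suc j < N \<Longrightarrow> e j = - (a (int j) * c (int j))"
    and n: "n \<le> N"
  shows "(\<Prod>j<n. a (int j)) * z (int n) =
    continuant e (\<lambda>j. b (int j)) 0 (Suc n) * z 0
    - c (-1) * continuant e (\<lambda>j. b (int j)) 1 n * z (-1)"
  using n
proof (induction n rule: induct_nat_012)
  case 0
  show ?case by simp
next
  case 1
  have "a 0 * z (0 + 1) - b 0 * z 0 + c (0 - 1) * z (0 - 1) = 0"
    using sol unfolding is_solution_def by blast
  then show ?case by (simp add: algebra_simps)
next
  case (ge2 n)
  let ?K = "continuant e (\<lambda>j. b (int j))"
  have eq: "a (int (Suc n)) * z (int (Suc (Suc n))) =
      b (int (Suc n)) * z (int (Suc n)) - c (int n) * z (int n)"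
    using sol[unfolded is_solution_def, rule_format, of "int (Suc n)"]
    by (simp add: algebra_simps)
  have "(\<Prod>j<Suc (Suc n). a (int j)) * z (int (Suc (Suc n)))
      = (\<Prod>j<Suc n. a (int j)) * (a (int (Suc n)) * z (int (Suc (Suc n))))"
    by (simp add: algebra_simps)
  also have "\<dots> = b (int (Suc n)) * ((\<Prod>j<Suc n. a (int j)) * z (int (Suc n)))
      + e n * ((\<Prod>j<n. a (int j)) * z (int n))"
    unfolding eq using ge2.prems by (simp add: e algebra_simps)
  also have "\<dots> = b (int (Suc n)) * (?K 0 (Suc (Suc n)) * z 0 - c (-1) * ?K 1 (Suc n) * z (-1))
      + e n * (?K 0 (Suc n) * z 0 - c (-1) * ?K 1 n * z (-1))"
    using ge2 by simp
  also have "\<dots> = ?K 0 (Suc (Suc (Suc n))) * z 0 - c (-1) * ?K 1 (Suc (Suc n)) * z (-1)"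
    by (simp add: algebra_simps)
  finally show ?case .
qed

text \<open>The factor \<open>1/r\<close> sits on the closing edge because the equation at \<open>0\<close> involves \<open>c(-1)\<close>, which
  is \<open>c(p - 1)/r\<close>.\<close>

definition cyclic_edge ::
  "nat \<Rightarrow> complex \<Rightarrow> (int \<Rightarrow> complex) \<Rightarrow> (int \<Rightarrow> complex) \<Rightarrow> nat \<Rightarrow> complex" where
  "cyclic_edge p r a c j = - (a (int j) * c (int j)) * (if j = p - 1 then inverse r else 1)"

text \<open>The trace of the monodromy matrix multiplied by \<open>a(0) \<dots> a(p - 1)\<close>, in combinatorial form.\<close>

definition monodromy_trace ::
  "nat \<Rightarrow> complex \<Rightarrow> (int \<Rightarrow> complex) \<Rightarrow> (int \<Rightarrow> complex) \<Rightarrow> (int \<Rightarrow> complex) \<Rightarrow> complex" where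
  "monodromy_trace p r a b c =
    (\<Sum>E\<in>cycle_matchings p. cycle_weight (cyclic_edge p r a c) (\<lambda>j. b (int j)) p E)"

text \<open>Cayley-Hamilton for a two by two matrix \<open>M\<close>, applied to a vector: if \<open>M\<close> maps
  \<open>(y0, y1)\<close> to \<open>(x0', y0')\<close> and this vector to \<open>(z0, z0')\<close>, then \<open>M\<^sup>2 - (tr M) M + det M = 0\<close> gives the two
  conclusions. Here \<open>M\<close> has the rows \<open>(R, -g S)/(A a')\<close> and \<open>(P, -g Q)/A\<close>, and its determinant is
  \<open>C g/(A a')\<close> by the assumption on \<open>P S - R Q\<close>.\<close>

lemma cayley_hamilton_three_term:
  fixes A a' C g P Q R S :: "'a::field"
  assumes nz: "A \<noteq> 0" "a' \<noteq> 0"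
    and det: "P * S - R * Q = A * C"
    and y: "A * y0' = P * y0 - g * Q * y1" "A * a' * x0' = R * y0 - g * S * y1"
    and x: "A * z0' = P * x0' - g * Q * y0'" "A * a' * z0 = R * x0' - g * S * y0'"
  shows "z0 - (R - a' * g * Q) / (A * a') * x0' + C * g / (A * a') * y0 = 0"
    and "z0' - (R - a' * g * Q) / (A * a') * y0' + C * g / (A * a') * y1 = 0"
proof -
  have "A * (A * a' * z0 - (R - a' * g * Q) * x0' + C * g * y0)
      = g * Q * (A * a' * x0') - g * S * (A * y0') + g * (A * C) * y0"
    unfolding x(2) by (simp add: algebra_simps)
  also have "\<dots> = 0"
    unfolding y det[symmetric] by (simp add: algebra_simps)
  finally have "A * a' * z0 - (R - a' * g * Q) * x0' + C * g * y0 = 0"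
    using nz by simp
  then show "z0 - (R - a' * g * Q) / (A * a') * x0' + C * g / (A * a') * y0 = 0"
    using nz by (simp add: field_simps)
next
  have "A * (a' * (A * z0') - (R - a' * g * Q) * y0' + C * g * y1)
      = P * (A * a' * x0') - R * (A * y0') + g * (A * C) * y1"
    unfolding x(1) by (simp add: algebra_simps)
  also have "\<dots> = 0"
    unfolding y det[symmetric] by (simp add: algebra_simps)
  finally have "a' * (A * z0') - (R - a' * g * Q) * y0' + C * g * y1 = 0"
    using nz by simp
  then show "z0' - (R - a' * g * Q) / (A * a') * y0' + C * g / (A * a') * y1 = 0"
    using nz by (simp add: field_simps)
qed

text \<open>This is Cayley-Hamilton for the monodromy matrix. The two instances at \<open>k = 0\<close>
  and \<open>k = -1\<close> come from the matrix that starts at \<open>0\<close>, applied to \<open>z\<close> and to its shift by one period back;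
  the linearity and the periodicity of the equation spread them to all \<open>k\<close>, so that monodromy matrices
  with other base points never occur.\<close>

lemma floquet_relation:
  assumes p: "1 \<le> p" and r: "r \<noteq> 0"
    and a: "a \<in> qper_nz p r" and c: "c \<in> qper_nz p r" and b: "b \<in> qper p r"
    and sol: "is_solution a b c z"
  defines "A \<equiv> \<Prod>j<p. a (int j)" and "C \<equiv> \<Prod>j<p. c (int j)"
  shows "z (k + int p) - monodromy_trace p r a b c / A * z k + C / (r * A) * z (k - int p) = 0"
proof -
  have aq: "a \<in> qper p r" and anz: "a j \<noteq> 0" for j
    using a by (auto simp: qper_nz_def)
  have cq: "c \<in> qper p r" and cnz: "c j \<noteq> 0" for j
    using c by (auto simp: qper_nz_def)
  obtain n where n: "p = Suc n"
    using p by (cases p) auto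
  define y where "y k = z (k - int p)" for k
  have "is_solution a b c (\<lambda>k. y (k + int p))"
    using sol by (simp add: y_def)
  then have soly: "is_solution a b c y"
    using is_solution_shift[OF r aq b cq] by blast
  have solx: "is_solution a b c (\<lambda>k. z (k + int p))"
    using is_solution_shift[OF r aq b cq] sol by blast
  define e where "e = cyclic_edge p r a c"
  define K where "K = continuant e (\<lambda>j. b (int j))"
  define A' where "A' = (\<Prod>j<n. a (int j))"
  define C' where "C' = (\<Prod>j<n. c (int j))"
  have A: "A = A' * a (int n)" and C: "C = C' * c (int n)"
    by (simp_all add: A_def C_def A'_def C'_def n)
  have A'nz: "A' \<noteq> 0"
    by (simp add: A'_def anz)
  have ee: "e j = - (a (int j) * c (int j))" if "Suc j < p" for j
  proof -
    have "j \<noteq> p - 1" using that by linarith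
    then show ?thesis by (simp add: e_def cyclic_edge_def)
  qed
  \<comment> \<open>By periodicity the weight of the closing edge is the coefficient \<open>c (-1)\<close> of the equation
    at \<open>0\<close> times \<open>-a (p - 1)\<close>.\<close>
  have cn: "c (int n) = r * c (-1)"
    using qperD[OF cq, of "-1"] by (simp add: n)
  have en: "e n = - (a (int n) * c (-1))"
    using r by (simp add: e_def cyclic_edge_def n cn)
  have "(\<Prod>j<n. - e j) = A' * C'"
    using ee by (simp add: A'_def C'_def n prod.distrib)
  then have det: "K 0 p * K 1 p - K 0 (Suc p) * K 1 n = A' * C'"
    unfolding K_def n continuant_determinant .
  have low: "A' * x (int n) = K 0 p * x 0 - c (-1) * K 1 n * x (-1)"
    and high: "A * x (int p) = K 0 (Suc p) * x 0 - c (-1) * K 1 p * x (-1)"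
    if "is_solution a b c x" for x
    using solution_eq_continuants[where N = p and n = n, OF that ee]
      solution_eq_continuants[where N = p and n = p, OF that ee]
    unfolding A'_def A_def K_def n by (simp_all del: continuant.simps)
  have t: "monodromy_trace p r a b c = K 0 (Suc p) - a (int n) * c (-1) * K 1 n"
    using sum_cycle_matchings[OF p, of e "\<lambda>j. b (int j)"] en
    unfolding monodromy_trace_def e_def[symmetric] by (simp add: K_def[symmetric] n)
  have d: "C / (r * (A' * a (int n))) = C' * c (-1) / (A' * a (int n))"
    using r by (simp add: C cn)
  define w where
    "w k = z (k + int p) - monodromy_trace p r a b c / A * z k + C / (r * A) * y k" for k
  have "is_solution a b c w"
    unfolding w_def by (rule is_solution_combination[OF solx sol soly])
  moreover have yz: "y (int n) = z (-1)" "y (int p) = z 0" and zn: "z (-1 + int p) = z (int n)"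
    by (simp_all add: y_def n)
  have "w 0 = 0" "w (-1) = 0"
    using cayley_hamilton_three_term[OF A'nz anz det
        low[OF soly, unfolded yz] high[OF soly, unfolded yz A] low[OF sol] high[OF sol, unfolded A]]
    unfolding w_def zn d t A by simp_all
  ultimately have "w k = 0"
    using solution_zero anz cnz by blast
  then show ?thesis
    by (simp add: w_def y_def)
qed

section \<open>The Floquet function\<close>

text \<open>The relation over one period, multiplied by \<open>\<gamma>\<^sup>-\<^sup>k\<^sup>-\<^sup>1\<close>, is the Chebyshev equation. For
  uniqueness, subtract the equations at \<open>k = 0\<close> of two candidates for a solution with \<open>z(0) = 1\<close>.\<close>

lemma floquet_q_eqI:
  assumes nz: "\<And>k. a k \<noteq> 0" "\<And>k. c k \<noteq> 0" and g: "\<gamma> \<noteq> 0"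
    and rel: "\<And>z k. is_solution a b c z \<Longrightarrow>
      z (k + int p) - 2 * q * \<gamma> * z k + \<gamma>\<^sup>2 * z (k - int p) = 0"
  shows "floquet_q p \<gamma> a b c = q"
  unfolding floquet_q_def
proof (rule the_equality)
  have cheb: "chebyshev_eq q (\<lambda>k. \<gamma> powi (- k) * subseq_of p m z k)" if "is_solution a b c z" for z m
    unfolding chebyshev_eq_def
  proof
    fix k
    have "\<gamma> powi (- (k + 1)) * subseq_of p m z (k + 1)
        - 2 * q * (\<gamma> powi (- k) * subseq_of p m z k)
        + \<gamma> powi (- (k - 1)) * subseq_of p m z (k - 1)
      = \<gamma> powi (- k - 1) * (z (k * int p + m + int p) - 2 * q * \<gamma> * z (k * int p + m)
          + \<gamma>\<^sup>2 * z (k * int p + m - int p))"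
    proof -
      have "\<gamma> powi (- k) = \<gamma> powi (- k - 1) * \<gamma>" "\<gamma> powi (- (k - 1)) = \<gamma> powi (- k - 1) * \<gamma>\<^sup>2"
        using g power_int_add[of \<gamma> "- k - 1" 1] power_int_add[of \<gamma> "- k - 1" 2] by simp_all
      moreover have "- (k + 1) = - k - 1" by simp
      moreover define G where "G = \<gamma> powi (- k - 1)"
      ultimately show ?thesis
        by (simp only: subseq_of_def) (simp add: algebra_simps)
    qed
    then show "\<gamma> powi (- (k + 1)) * subseq_of p m z (k + 1)
        - 2 * q * (\<gamma> powi (- k) * subseq_of p m z k)
        + \<gamma> powi (- (k - 1)) * subseq_of p m z (k - 1) = 0"
      using rel[OF that] by simp
  qed
  then show "\<forall>z. is_solution a b c z \<longrightarrow>
      (\<forall>m. chebyshev_eq q (\<lambda>k. \<gamma> powi (- k) * subseq_of p m z k))"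
    by blast
  fix q'
  assume q': "\<forall>z. is_solution a b c z \<longrightarrow>
      (\<forall>m. chebyshev_eq q' (\<lambda>k. \<gamma> powi (- k) * subseq_of p m z k))"
  obtain z where z: "is_solution a b c z" "z 0 = 1"
    using ex_solution_nonzero[of a c b, OF nz] by blast
  define v where "v k = \<gamma> powi (- k) * subseq_of p 0 z k" for k
  have "v (0 + 1) - 2 * q * v 0 + v (0 - 1) = 0" "v (0 + 1) - 2 * q' * v 0 + v (0 - 1) = 0"
    using cheb[OF z(1), of 0] q' z(1) unfolding chebyshev_eq_def v_def by blast+
  moreover have "v 0 = 1"
    using z(2) by (simp add: v_def subseq_of_def)
  ultimately show "q' = q"
    by (simp add: algebra_simps)
qed

lemma cycle_weight_eq_mpow:
  assumes p: "1 \<le> p" and E: "E \<in> cycle_matchings p"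
  defines "\<alpha> \<equiv> indicator_list p E"
  shows "cycle_weight (cyclic_edge p r a c) (\<lambda>j. b (int j)) p E =
    (-1) ^ card E *
      (r powi (- int (\<alpha> ! (p - 1))) * mpow a \<alpha> * mpow b (bar_idx \<alpha>) * mpow c \<alpha>)"
proof -
  have sub: "E \<subseteq> {..<p}" and fin: "finite E"
    using E by (auto simp: cycle_matchings_def intro: finite_subset[of E "{..<p}"])
  have "(\<Prod>s\<in>E. cyclic_edge p r a c s) =
      (\<Prod>s\<in>E. - 1 * a (int s) * c (int s) * (if s = p - 1 then inverse r else 1))"
    by (simp add: cyclic_edge_def)
  also have "\<dots> = (-1) ^ card E * mpow a \<alpha> * mpow c \<alpha> * (if p - 1 \<in> E then inverse r else 1)"
    unfolding prod.distrib using fin sub by (simp add: \<alpha>_def mpow_indicator_list)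
  also have "(if p - 1 \<in> E then inverse r else 1) = r powi (- int (\<alpha> ! (p - 1)))"
    using p by (simp add: \<alpha>_def nth_indicator_list power_int_minus)
  finally show ?thesis
    unfolding cycle_weight_def \<alpha>_def bar_idx_indicator_list[OF sub]
    by (simp add: mpow_indicator_list algebra_simps)
qed

lemma mpow_ones: "mpow x (ones p) = (\<Prod>j<p. x (int j))"
  by (auto simp: mpow_def ones_def intro!: prod.cong)

theorem theorem4p4:
  fixes p :: nat and r \<gamma> s :: complex and a b c :: "int \<Rightarrow> complex"
  assumes "1 \<le> p"
    and "r \<noteq> 0"
    and "a \<in> qper_nz p r"
    and "c \<in> qper_nz p r"
    and "b \<in> qper p r"
    and "is_gamma p r a c \<gamma>"
    and "s\<^sup>2 = r / (mpow a (ones p) * mpow c (ones p))"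
    and "s = 1 / (\<gamma> * mpow a (ones p))"
  shows "floquet_q p \<gamma> a b c =
    1 / 2 * s *
      (\<Sum>j = 0..p div 2. (-1) ^ j *
        (\<Sum>\<alpha>\<in>Lam p j. r powi (- int (\<alpha> ! (p - 1))) *
           mpow a \<alpha> * mpow b (bar_idx \<alpha>) * mpow c \<alpha>))"
proof -
  define A where "A = (\<Prod>j<p. a (int j))"
  define C where "C = (\<Prod>j<p. c (int j))"
  have anz: "a k \<noteq> 0" and cnz: "c k \<noteq> 0" for k
    using assms(3,4) by (auto simp: qper_nz_def)
  have nz: "A \<noteq> 0" "C \<noteq> 0"
    by (simp_all add: A_def C_def anz cnz)
  have g2: "\<gamma>\<^sup>2 = C / (r * A)"
    using assms(6) by (simp add: is_gamma_def A_def C_def prod_dividef)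
  then have g: "\<gamma> \<noteq> 0"
    using nz assms(2) by auto
  have "floquet_q p \<gamma> a b c = 1 / 2 * s * monodromy_trace p r a b c"
  proof (rule floquet_q_eqI[OF anz cnz g])
    fix z k
    assume "is_solution a b c z"
    moreover have "2 * (1 / 2 * s * monodromy_trace p r a b c) * \<gamma> = monodromy_trace p r a b c / A"
      using g by (simp add: assms(8) mpow_ones A_def)
    ultimately show "z (k + int p) - 2 * (1 / 2 * s * monodromy_trace p r a b c) * \<gamma> * z k
        + \<gamma>\<^sup>2 * z (k - int p) = 0"
      using floquet_relation[OF assms(1-5)] by (simp add: g2 A_def C_def)
  qed
  also have "monodromy_trace p r a b c =
      (\<Sum>j = 0..p div 2. (-1) ^ j *
        (\<Sum>\<alpha>\<in>Lam p j. r powi (- int (\<alpha> ! (p - 1))) *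
           mpow a \<alpha> * mpow b (bar_idx \<alpha>) * mpow c \<alpha>))"
    unfolding monodromy_trace_def sum_Lam_eq_sum_cycle_matchings[OF assms(1)]
    by (rule sum.cong) (simp_all only: cycle_weight_eq_mpow[OF assms(1)])
  finally show ?thesis .
qed

end
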